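(* Let $q$ be a prime power and $n\geq 1$. Then $$\sum_{F\in\mathcal{F}_q(n)} q^{w(F)}=\prod_{k=1}^{n}\Big((1+q^{n-k})\,(k)_q\Big)^{\begin{bmatrix} n\\ k\end{bmatrix}_q}.$$
   Context: For a nonnegative integer $m$, $(m)_q=1+q+\cdots+q^{m-1}$, and $\begin{bmatrix} n\\ k\end{bmatrix}_q$ is the number of $k$-dimensional subspaces of $\mathbb{F}_q^n$. $C_q(n)$ is the graph whose vertices are all subspaces of $\mathbb{F}_q^n$, with an edge between $X$ and $Y$ whenever one contains the other and their dimensions differ by exactly $1$ (the Hasse diagram of the subspace lattice). A rooted spanning tree of $C_q(n)$ is a pair consisting of a spanning tree of $C_q(n)$ and a choice of a vertex (the root); $\mathcal{F}_q(n)$ is the set of all rooted spanning trees of $C_q(n)$ (over all possible roots). For $F\in\mathcal{F}_q(n)$, orient every edge of $F$ towards the root; an oriented edge $(X,Y)$ (from $X$ to $Y$) is called spin up if $\dim Y=\dim X+1$. The weight of $F$ is $w(F)=\sum \dim X$, the sum over all spin up oriented edges $(X,Y)$ of $F$. *)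

theory Defs
  imports
    "HOL-Analysis.Cartesian_Space"
    "HOL-Number_Theory.Prime_Powers"
begin

section \<open>Simple undirected graphs\<close>

text \<open>
  A graph is given by its vertex set \<open>V\<close> and its edge set \<open>E\<close>, a set of two-element subsets
  of \<open>V\<close>.
\<close>

definition is_path :: "'v set \<Rightarrow> 'v set set \<Rightarrow> 'v list \<Rightarrow> bool" where
  "is_path V E p \<longleftrightarrow>
     p \<noteq> [] \<and> set p \<subseteq> V \<and> distinct p \<and> successively (\<lambda>x y. {x, y} \<in> E) p"

definition is_cycle :: "'v set \<Rightarrow> 'v set set \<Rightarrow> 'v list \<Rightarrow> bool" where
  "is_cycle V E p \<longleftrightarrow> is_path V E p \<and> length p \<ge> 3 \<and> {last p, hd p} \<in> E"

definition connected_graph :: "'v set \<Rightarrow> 'v set set \<Rightarrow> bool" where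
  "connected_graph V E \<longleftrightarrow>
     V \<noteq> {} \<and> (\<forall>u\<in>V. \<forall>v\<in>V. \<exists>p. is_path V E p \<and> hd p = u \<and> last p = v)"

definition is_tree :: "'v set \<Rightarrow> 'v set set \<Rightarrow> bool" where
  "is_tree V E \<longleftrightarrow> connected_graph V E \<and> (\<nexists>p. is_cycle V E p)"

text \<open>A spanning tree has vertex set \<open>V\<close>, so it is identified with its edge set.\<close>

definition spanning_tree :: "'v set \<Rightarrow> 'v set set \<Rightarrow> 'v set set \<Rightarrow> bool" where
  "spanning_tree V E T \<longleftrightarrow> T \<subseteq> E \<and> is_tree V T"

definition rooted_spanning_trees :: "'v set \<Rightarrow> 'v set set \<Rightarrow> ('v set set \<times> 'v) set" where
  "rooted_spanning_trees V E = {(T, r). spanning_tree V E T \<and> r \<in> V}"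

text \<open>
  The edges of the tree \<open>T\<close> oriented towards the root \<open>r\<close>: the edge between \<open>x\<close> and \<open>y\<close> is oriented
  from \<open>x\<close> to \<open>y\<close> if the path in \<open>T\<close> from \<open>x\<close> to \<open>r\<close> starts with this edge.
\<close>

definition oriented_edges :: "'v set \<Rightarrow> 'v set set \<times> 'v \<Rightarrow> ('v \<times> 'v) set" where
  "oriented_edges V = (\<lambda>(T, r). {(x, y). \<exists>p. is_path V T (x # y # p) \<and> last (x # y # p) = r})"

section \<open>The Hasse diagram of the subspace lattice\<close>

text \<open>
  The space is \<open>'a ^ 'n\<close> with \<open>'a\<close> a finite field, so \<open>q = CARD('a)\<close> and \<open>n = CARD('n)\<close>.
  The prefix \<open>vec\<close> refers to the vector space structure over \<open>'a\<close> itself.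
\<close>

definition Cq_verts :: "('a::{field,finite} ^ 'n) set set" where
  "Cq_verts = {X. vec.subspace X}"

definition Cq_edges :: "('a::{field,finite} ^ 'n) set set set" where
  "Cq_edges = {{X, Y} | X Y.
     X \<in> Cq_verts \<and> Y \<in> Cq_verts \<and> X \<subseteq> Y \<and> vec.dim Y = vec.dim X + 1}"

definition Cq_rooted_trees ::
  "(('a::{field,finite} ^ 'n) set set set \<times> ('a ^ 'n) set) set" where
  "Cq_rooted_trees = rooted_spanning_trees Cq_verts Cq_edges"

definition spin_up_edges ::
  "('a::{field,finite} ^ 'n) set set set \<times> ('a ^ 'n) set \<Rightarrow> (('a ^ 'n) set \<times> ('a ^ 'n) set) set" where
  "spin_up_edges F = {(X, Y) \<in> oriented_edges Cq_verts F. vec.dim Y = vec.dim X + 1}"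

definition weight ::
  "('a::{field,finite} ^ 'n) set set set \<times> ('a ^ 'n) set \<Rightarrow> nat" where
  "weight F = (\<Sum>(X, Y)\<in>spin_up_edges F. vec.dim X)"

section \<open>q-analogues\<close>

definition q_int :: "nat \<Rightarrow> nat \<Rightarrow> nat" where
  "q_int q m = (\<Sum>i<m. q ^ i)"

definition q_binomial :: "('a::{field,finite} ^ 'n) itself \<Rightarrow> nat \<Rightarrow> nat" where
  "q_binomial _ k = card {X :: ('a ^ 'n) set. vec.subspace X \<and> vec.dim X = k}"

end

theory Submission
  imports Defs
    "HOL-Analysis.Determinants"
    "HOL-Computational_Algebra.Polynomial"
begin

text \<open>
  Give the oriented edge \<open>(X, Y)\<close> the weight \<open>q\<^sup>d\<close> with \<open>d = dim X\<close> if \<open>Y\<close> covers \<open>X\<close>, and \<open>1\<close> if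
  \<open>X\<close> covers \<open>Y\<close>, and let \<open>L\<close> be the weighted Laplacian. By the matrix-tree theorem the left-hand
  side is the coefficient of \<open>t\<close> in \<open>det (t + L)\<close>. All weighted out-degrees equal \<open>(n)\<^sub>q\<close>, and the
  columns \<open>X \<mapsto> q ^ (dim Z * (n - dim X))\<close>, supported on \<open>X \<supseteq> Z\<close>, triangularise \<open>L\<close>: applying
  \<open>L\<close> to the column of \<open>Z\<close> gives \<open>(1 + q ^ (n - k)) (k)\<^sub>q\<close> times itself, where \<open>k = dim Z\<close>, minus
  \<open>q ^ (n - k)\<close> times the sum of the columns of the hyperplanes of \<open>Z\<close>. The factor \<open>k = 0\<close> of the
  resulting determinant is \<open>t\<close>.
\<close>

section \<open>Determinants and the matrix-tree theorem\<close>

text \<open>A level function replaces a linear order of the indices. If a permutation term is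
  nonzero, \<open>h\<close> weakly increases along \<open>p\<close>, strictly at any moved index;
  but \<open>p\<close> preserves the total of \<open>h\<close>, so only the identity
  survives.\<close>

lemma det_triangular:
  fixes A :: "'a::comm_ring_1 ^ 'v ^ 'v" and h :: "'v::finite \<Rightarrow> nat"
  assumes "\<And>x y. A $ x $ y \<noteq> 0 \<Longrightarrow> x = y \<or> h x < h y"
  shows "det A = (\<Prod>x\<in>UNIV. A $ x $ x)"
proof -
  have zero: "(\<Prod>x\<in>UNIV. A $ x $ p x) = 0" if p: "p permutes UNIV" and "p \<noteq> id" for p
  proof (rule ccontr)
    assume "(\<Prod>x\<in>UNIV. A $ x $ p x) \<noteq> 0"
    then have nz: "A $ x $ p x \<noteq> 0" for x
      using prod_zero[of UNIV "\<lambda>x. A $ x $ p x"] by auto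
    obtain x where "p x \<noteq> x"
      using \<open>p \<noteq> id\<close> by (auto simp: fun_eq_iff)
    have "(\<Sum>y\<in>UNIV. h y) < (\<Sum>y\<in>UNIV. h (p y))"
    proof (rule sum_strict_mono_ex1)
      show "\<forall>y\<in>UNIV. h y \<le> h (p y)"
        using assms[OF nz] by (metis less_imp_le order_refl)
      show "\<exists>y\<in>UNIV. h y < h (p y)"
        using assms[OF nz, of x] \<open>p x \<noteq> x\<close> by auto
    qed simp
    moreover have "(\<Sum>y\<in>UNIV. h (p y)) = (\<Sum>y\<in>UNIV. h y)"
      using sum.permute[OF p, of h] by (simp add: comp_def)
    ultimately show False by simp
  qed
  have "det A = (\<Sum>p\<in>{id}. of_int (sign p) * (\<Prod>x\<in>UNIV. A $ x $ p x))"
    unfolding det_def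
    by (rule sum.mono_neutral_right) (auto simp: zero finite_permutations)
  then show ?thesis by simp
qed

text \<open>Multilinearity in all rows at once: distributing each product in the Leibniz formula
  gives one summand for every choice function \<open>f\<close>.\<close>

lemma det_rows_sum:
  fixes a :: "'v::finite \<Rightarrow> 's::finite \<Rightarrow> 'a::comm_ring_1 ^ 'v"
  shows "det (\<chi> x. \<Sum>s\<in>UNIV. a x s) = (\<Sum>f\<in>UNIV. det (\<chi> x. a x (f x)))"
proof -
  have "(\<Prod>x\<in>UNIV. \<Sum>s\<in>UNIV. a x s $ p x) = (\<Sum>f\<in>UNIV. \<Prod>x\<in>UNIV. a x (f x) $ p x)" for p
    by (subst prod_sum_PiE) (auto simp: PiE_UNIV_domain)
  then have "det (\<chi> x. \<Sum>s\<in>UNIV. a x s) =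
      (\<Sum>p | p permutes UNIV. \<Sum>f\<in>UNIV. of_int (sign p) * (\<Prod>x\<in>UNIV. a x (f x) $ p x))"
    unfolding det_def by (simp add: sum_distrib_left)
  also have "\<dots> = (\<Sum>f\<in>UNIV. det (\<chi> x. a x (f x)))"
    unfolding det_def by (subst sum.swap) simp
  finally show ?thesis .
qed

section \<open>Parent functions and their forests\<close>

text \<open>Pairs are (parent, child), so well-foundedness says that following parents always stops;
  \<open>None\<close> marks a root. The well-founded parent functions are the rooted
  forests.\<close>

definition parent_rel :: "('v \<Rightarrow> 'v option) \<Rightarrow> ('v \<times> 'v) set" where
  "parent_rel f = {(y, x). f x = Some y}"

text \<open>The height counts proper ancestors. A child inherits those of its parent and gains the
  parent itself, which acyclicity keeps out of its own ancestor set.\<close>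

lemma parent_rel_height:
  fixes f :: "'v::finite \<Rightarrow> 'v option"
  assumes "wf (parent_rel f)"
  obtains h :: "'v \<Rightarrow> nat" where "\<And>x y. f x = Some y \<Longrightarrow> h y < h x"
proof (rule that)
  fix x y assume "f x = Some y"
  then have yx: "(y, x) \<in> (parent_rel f)\<^sup>+"
    by (auto simp: parent_rel_def)
  have "(y, y) \<notin> (parent_rel f)\<^sup>+"
    using wf_acyclic[OF assms] by (simp add: acyclic_def)
  with yx have "{z. (z, y) \<in> (parent_rel f)\<^sup>+} \<subset> {z. (z, x) \<in> (parent_rel f)\<^sup>+}"
    using trancl_trans[OF _ yx] by blast
  then show "card {z. (z, y) \<in> (parent_rel f)\<^sup>+} < card {z. (z, x) \<in> (parent_rel f)\<^sup>+}"
    by (simp add: psubset_card_mono)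
qed

text \<open>For a forest the matrix is triangular along heights with unit diagonal. Otherwise some
  chain of parents never ends, and this yields a kernel vector.\<close>

lemma det_parent_matrix:
  fixes f :: "'v::finite \<Rightarrow> 'v option"
  shows "det ((\<chi> x y. (if x = y then 1 else 0) - (if f x = Some y then 1 else 0)) :: 'a::field ^ 'v ^ 'v) =
    (if wf (parent_rel f) then 1 else 0)"
    (is "det ?A = _")
proof (cases "wf (parent_rel f)")
  case True
  then obtain h :: "'v \<Rightarrow> nat" where h: "\<And>x y. f x = Some y \<Longrightarrow> h y < h x"
    by (rule parent_rel_height) blast
  have irr: "f x \<noteq> Some x" for x
    using h[of x x] by auto
  \<comment> \<open>Heights drop from child to parent, whereas \<open>det_triangular\<close> wants
    them to rise from row to column; hence the transpose.\<close>
  have "det (transpose ?A) = (\<Prod>x\<in>UNIV. transpose ?A $ x $ x)"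
    by (rule det_triangular[where h = h]) (auto simp: transpose_def h split: if_splits)
  also have "\<dots> = 1"
    by (simp add: transpose_def irr)
  finally show ?thesis
    using True by simp
next
  case False
  \<comment> \<open>\<open>C\<close> holds the vertices whose chain of parents never ends. A vertex
    lies in \<open>C\<close> iff it has a parent in \<open>C\<close>, so the matrix kills the
    indicator of \<open>C\<close>.\<close>
  define C where "C = - Wellfounded.acc (parent_rel f)"
  have acc: "x \<in> Wellfounded.acc (parent_rel f) \<longleftrightarrow>
      (\<forall>y. f x = Some y \<longrightarrow> y \<in> Wellfounded.acc (parent_rel f))" for x
    by (auto simp: parent_rel_def elim: acc.cases intro: acc.intros)
  obtain c where c: "c \<in> C"
    using False unfolding C_def by (auto simp: wf_iff_acc)
  let ?v = "(\<chi> x. if x \<in> C then 1 else 0) :: 'a ^ 'v"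
  have "?v \<noteq> 0"
    using c by (auto simp: vec_eq_iff)
  moreover have "?A *v ?v = 0"
  proof (subst vec_eq_iff, rule allI)
    fix x
    have "(?A *v ?v) $ x =
        (\<Sum>y\<in>UNIV. (if x = y then ?v $ y else 0)) - (\<Sum>y\<in>UNIV. (if f x = Some y then ?v $ y else 0))"
      unfolding matrix_vector_mult_def sum_subtractf[symmetric]
      by (auto simp: left_diff_distrib intro!: sum.cong)
    also have "(\<Sum>y\<in>UNIV. (if f x = Some y then ?v $ y else 0)) = ?v $ x"
    proof (cases "f x")
      case None
      then show ?thesis using acc[of x] by (auto simp: C_def)
    next
      case (Some y)
      then have "x \<in> C \<longleftrightarrow> y \<in> C" using acc[of x] by (auto simp: C_def)
      then show ?thesis using Some by simp
    qed
    finally show "(?A *v ?v) $ x = 0 $ x" by simp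
  qed
  ultimately have "\<not> invertible ?A"
    unfolding invertible_left_inverse matrix_left_invertible_ker by blast
  then have "det ?A = 0"
    by (simp only: invertible_det_nz not_not)
  then show ?thesis using False by simp
qed

text \<open>
  Row \<open>x\<close> is \<open>t x\<close> times the unit vector \<open>e x\<close> plus the sum of the vectors \<open>e x - e y\<close> with
  coefficients \<open>w x y\<close>, so multilinearity of the determinant expands it over all parent functions.
\<close>

theorem forest_theorem:
  fixes w :: "'v::finite \<Rightarrow> 'v \<Rightarrow> 'a::field"
  shows "det (\<chi> x y. (if x = y then t x + (\<Sum>z\<in>UNIV. w x z) else 0) - w x y) =
    (\<Sum>f | wf (parent_rel f). \<Prod>x\<in>UNIV. case f x of None \<Rightarrow> t x | Some y \<Rightarrow> w x y)"
    (is "det ?L = _")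
proof -
  define L where "L = ?L"
  define c where "c x s = (case s of None \<Rightarrow> t x | Some y \<Rightarrow> w x y)" for x s
  define e :: "'v \<Rightarrow> 'v option \<Rightarrow> 'a ^ 'v" where
    "e x s = (\<chi> y. (if x = y then 1 else 0) - (if s = Some y then 1 else 0))" for x s
  have row: "(\<Sum>s\<in>UNIV. c x s *s e x s) = L $ x" for x
  proof (subst vec_eq_iff, rule allI)
    fix y
    have "(\<Sum>s\<in>UNIV. c x s *s e x s) $ y =
        c x None * e x None $ y + (\<Sum>z\<in>UNIV. c x (Some z) * e x (Some z) $ y)"
      unfolding UNIV_option_conv by (simp add: sum.reindex)
    also have "\<dots> = L $ x $ y"
      by (simp add: c_def e_def L_def right_diff_distrib sum_subtractf
          if_distrib[where f = "(*) _"] cong: if_cong)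
    finally show "(\<Sum>s\<in>UNIV. c x s *s e x s) $ y = L $ x $ y" .
  qed
  have "L = (\<chi> x. \<Sum>s\<in>UNIV. c x s *s e x s)"
    by (simp only: row vec_lambda_eta)
  then have "det L = (\<Sum>f\<in>UNIV. det (\<chi> x. c x (f x) *s e x (f x)))"
    by (simp only: det_rows_sum)
  also have "\<dots> = (\<Sum>f\<in>UNIV. (\<Prod>x\<in>UNIV. c x (f x)) * (if wf (parent_rel f) then 1 else 0))"
    by (simp only: det_rows_mul e_def det_parent_matrix)
  also have "\<dots> = (\<Sum>f | wf (parent_rel f). \<Prod>x\<in>UNIV. c x (f x))"
    by (simp add: if_distrib[where f = "(*) _"] sum.If_cases cong: if_cong)
  finally show ?thesis unfolding L_def c_def .
qed

section \<open>Rooted spanning trees as parent functions\<close>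

lemma is_path_Cons_Cons:
  "is_path V E (x # y # p) \<longleftrightarrow> x \<in> V \<and> x \<notin> set (y # p) \<and> {x, y} \<in> E \<and> is_path V E (y # p)"
  by (auto simp: is_path_def)

lemma is_path_mono: "is_path V E p \<Longrightarrow> E \<subseteq> E' \<Longrightarrow> is_path V E' p"
  unfolding is_path_def by (metis (no_types, lifting) subsetD successively_mono)

lemma is_path_append_left: "is_path V E (p @ q) \<Longrightarrow> p \<noteq> [] \<Longrightarrow> is_path V E p"
  by (auto simp: is_path_def successively_append_iff)

lemma is_path_snoc:
  assumes "is_path V E p" "{last p, y} \<in> E" "y \<in> V" "y \<notin> set p"
  shows "is_path V E (p @ [y])"
  using assms by (auto simp: is_path_def successively_append_iff)

text \<open>A walk shrinks to a path with the same ends: when the next vertex has occurred before,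
  the path is cut back to it.\<close>

lemma rtrancl_imp_path:
  assumes "(u, v) \<in> {(x, y). x \<in> V \<and> y \<in> V \<and> {x, y} \<in> E}\<^sup>*" "u \<in> V"
  shows "\<exists>p. is_path V E p \<and> hd p = u \<and> last p = v"
  using assms(1)
proof induction
  case base
  have "is_path V E [u]" using assms(2) by (simp add: is_path_def)
  then show ?case by force
next
  case (step y z)
  then obtain p where p: "is_path V E p" "hd p = u" "last p = y" by blast
  then have "p \<noteq> []" by (simp add: is_path_def)
  show ?case
  proof (cases "z \<in> set p")
    case True
    then obtain p1 p2 where "p = p1 @ z # p2" by (meson split_list)
    then have "is_path V E (p1 @ [z])"
      using p(1) is_path_append_left[of V E "p1 @ [z]" p2] by simp
    moreover have "hd (p1 @ [z]) = u"
      using p(2) \<open>p = p1 @ z # p2\<close> by (cases p1) simp_all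
    ultimately show ?thesis by (metis last_snoc)
  next
    case False
    then have "is_path V E (p @ [z])"
      using step(2) p by (intro is_path_snoc) simp_all
    moreover have "hd (p @ [z]) = u"
      using p(2) \<open>p \<noteq> []\<close> by simp
    ultimately show ?thesis by (metis last_snoc)
  qed
qed

text \<open>Lets a cycle start at any chosen vertex, later one of maximal height.\<close>

lemma is_cycle_rotate:
  assumes "is_cycle V E (p @ q)"
  shows "is_cycle V E (q @ p)"
proof (cases "p = [] \<or> q = []")
  case True
  then show ?thesis using assms by auto
next
  case False
  then have "successively (\<lambda>x y. {x, y} \<in> E) (q @ p)" "{last (q @ p), hd (q @ p)} \<in> E"
    using assms by (simp_all add: is_cycle_def is_path_def successively_append_iff)
  moreover have "distinct (q @ p)" "set (q @ p) \<subseteq> V" "length (q @ p) \<ge> 3" "q @ p \<noteq> []"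
    using assms by (auto simp: is_cycle_def is_path_def)
  ultimately show ?thesis unfolding is_cycle_def is_path_def by blast
qed

section \<open>Arborescences and their trees\<close>

definition tree_edges :: "('v \<Rightarrow> 'v option) \<Rightarrow> 'v set set" where
  "tree_edges f = {{x, y} | x y. f x = Some y}"

text \<open>\<open>V\<close> may be a proper subset of the type. Forcing \<open>None\<close> outside
  \<open>V\<close> makes the parent function of a rooted tree unique.\<close>

locale arborescence =
  fixes V :: "'v::finite set" and f :: "'v \<Rightarrow> 'v option" and r :: 'v
  assumes wf: "wf (parent_rel f)"
    and root: "r \<in> V"
    and None_iff: "f x = None \<longleftrightarrow> x \<notin> V \<or> x = r"
    and Some_in: "f x = Some y \<Longrightarrow> y \<in> V"
begin

lemma f_root: "f r = None"
  using None_iff by blast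

lemma Some_dom: "f x = Some y \<Longrightarrow> x \<in> V"
  using None_iff by (metis option.distinct(1))

lemma edge_iff: "{x, y} \<in> tree_edges f \<longleftrightarrow> f x = Some y \<or> f y = Some x"
  by (auto simp: tree_edges_def doubleton_eq_iff)

text \<open>Following parents reaches \<open>r\<close>. That the path begins with the parent of
  \<open>x\<close> is what identifies the orientation of the edges.\<close>

lemma path_to_root:
  assumes "x \<in> V"
  shows "\<exists>p. is_path V (tree_edges f) (x # p) \<and> last (x # p) = r \<and>
    (\<forall>y. f x = Some y \<longrightarrow> (\<exists>p'. p = y # p'))"
proof -
  obtain h :: "'v \<Rightarrow> nat" where h: "\<And>x y. f x = Some y \<Longrightarrow> h y < h x"
    using parent_rel_height[OF wf] by blast
  \<comment> \<open>The extra bound on heights keeps \<open>x\<close> off the path that starts at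
    its parent, so that the extended path stays simple.\<close>
  have "\<exists>p. is_path V (tree_edges f) (x # p) \<and> last (x # p) = r \<and>
      (\<forall>y. f x = Some y \<longrightarrow> (\<exists>p'. p = y # p')) \<and> (\<forall>z\<in>set p. h z < h x)"
    using assms
  proof (induction "h x" arbitrary: x rule: less_induct)
    case less
    show ?case
    proof (cases "f x")
      case None
      then have "x = r" using less.prems None_iff by blast
      then show ?thesis using None less.prems by (intro exI[of _ "[]"]) (auto simp: is_path_def)
    next
      case (Some y)
      obtain p where p: "is_path V (tree_edges f) (y # p)" "last (y # p) = r" "\<forall>z\<in>set p. h z < h y"
        using less.hyps[OF h[OF Some] Some_in[OF Some]] by blast
      have lt: "\<forall>z\<in>set (y # p). h z < h x"
        using p(3) h[OF Some] by auto
      then have "is_path V (tree_edges f) (x # y # p)"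
        using p(1) Some less.prems unfolding is_path_Cons_Cons edge_iff by blast
      then show ?thesis using p(2) lt Some by (intro exI[of _ "y # p"]) auto
    qed
  qed
  then show ?thesis by blast
qed

lemma connected: "connected_graph V (tree_edges f)"
proof -
  let ?R = "{(x, y). x \<in> V \<and> y \<in> V \<and> {x, y} \<in> tree_edges f}"
  have "(x, last (x # p)) \<in> ?R\<^sup>*" if "is_path V (tree_edges f) (x # p)" for x p
    using that
  proof (induction p arbitrary: x)
    case (Cons y p)
    then have "(x, y) \<in> ?R" "is_path V (tree_edges f) (y # p)" by (auto simp: is_path_def)
    then show ?case
      using converse_rtrancl_into_rtrancl[OF _ Cons.IH] by simp
  qed simp
  then have to_root: "(x, r) \<in> ?R\<^sup>*" if "x \<in> V" for x
    using path_to_root[OF that] by fastforce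
  have "sym (?R\<^sup>*)"
    by (rule sym_rtrancl) (auto simp: sym_def insert_commute)
  then have "(u, v) \<in> ?R\<^sup>*" if "u \<in> V" "v \<in> V" for u v
    using to_root[OF that(1)] to_root[OF that(2)] by (meson rtrancl_trans symD)
  then show ?thesis
    using root rtrancl_imp_path[of _ _ V "tree_edges f"] unfolding connected_graph_def by blast
qed

text \<open>At a vertex of maximal height both neighbours in a cycle would be its parent.\<close>

lemma no_cycle: "\<not> is_cycle V (tree_edges f) p"
proof
  assume cyc: "is_cycle V (tree_edges f) p"
  obtain h :: "'v \<Rightarrow> nat" where h: "\<And>x y. f x = Some y \<Longrightarrow> h y < h x"
    using parent_rel_height[OF wf] by blast
  have "p \<noteq> []" using cyc by (simp add: is_cycle_def is_path_def)
  then have "Max (h ` set p) \<in> h ` set p" by (intro Max_in) auto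
  then obtain x where x: "x \<in> set p" "\<And>y. y \<in> set p \<Longrightarrow> h y \<le> h x"
    by (metis (no_types, lifting) Max_ge finite_imageI finite_set imageE imageI)
  obtain p1 p2 where p: "p = p1 @ x # p2" using x(1) by (meson split_list)
  then have cyc': "is_cycle V (tree_edges f) (x # p2 @ p1)" using is_cycle_rotate[OF cyc[unfolded p]] by simp
  \<comment> \<open>A cycle has at least three vertices, so the neighbours \<open>y\<close> and
    \<open>last q\<close> of \<open>x\<close> are different.\<close>
  then obtain y q where yq: "p2 @ p1 = y # q" "q \<noteq> []"
    unfolding is_cycle_def by (cases "p2 @ p1") fastforce+
  have "set (y # q) \<subseteq> set p" using p unfolding yq(1)[symmetric] by auto
  then have le: "h y \<le> h x" "h (last q) \<le> h x" using x(2) last_in_set[OF yq(2)] by auto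
  have e: "{x, y} \<in> tree_edges f" "{last q, x} \<in> tree_edges f" "y \<noteq> last q"
    using cyc' yq by (auto simp: is_cycle_def is_path_def)
  have "f x = Some y" "f x = Some (last q)"
    using e(1,2) le h unfolding edge_iff by (metis leD)+
  with e(3) show False by simp
qed

lemma spanning_tree: "tree_edges f \<subseteq> E \<Longrightarrow> spanning_tree V E (tree_edges f)"
  using connected no_cycle by (auto simp: spanning_tree_def is_tree_def)

text \<open>A path whose first step leads away from the root never turns back.\<close>

lemma path_away_from_root:
  assumes "is_path V (tree_edges f) (x # y # p)" "f y = Some x"
  shows "f (last (y # p)) \<noteq> None"
  using assms
proof (induction p arbitrary: x y)
  case (Cons z p)
  then have "{y, z} \<in> tree_edges f" "z \<noteq> x" "is_path V (tree_edges f) (y # z # p)"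
    by (auto simp: is_path_def)
  then have "f z = Some y" using Cons.prems(2) by (auto simp: edge_iff)
  then show ?case using Cons.IH[OF \<open>is_path V (tree_edges f) (y # z # p)\<close>] by simp
qed simp

text \<open>The first edge of a path to \<open>r\<close> leads to the parent or to a child. After a
  step to a child the path ends at a vertex with a parent, which \<open>r\<close> is not.\<close>

lemma oriented_edges: "oriented_edges V (tree_edges f, r) = {(x, y). f x = Some y}"
proof -
  have "(\<exists>p. is_path V (tree_edges f) (x # y # p) \<and> last (x # y # p) = r) \<longleftrightarrow> f x = Some y" for x y
  proof
    assume "\<exists>p. is_path V (tree_edges f) (x # y # p) \<and> last (x # y # p) = r"
    then obtain p where p: "is_path V (tree_edges f) (x # y # p)" "last (y # p) = r" by auto
    then have "f x = Some y \<or> f y = Some x" by (simp add: is_path_Cons_Cons edge_iff)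
    then show "f x = Some y" using path_away_from_root[OF p(1)] p(2) f_root by auto
  next
    assume "f x = Some y"
    then show "\<exists>p. is_path V (tree_edges f) (x # y # p) \<and> last (x # y # p) = r"
      using path_to_root[OF Some_dom] by blast
  qed
  then show ?thesis by (simp add: oriented_edges_def)
qed

end

text \<open>
  Every tree arises from its own distance-to-the-root function: sending each vertex to a neighbour
  closer to the root gives a connected subgraph, and a further edge would close a cycle.
\<close>

lemma spanning_tree_arborescence:
  fixes V :: "'v::finite set"
  assumes "spanning_tree V E T" "r \<in> V"
    and edges: "\<And>e. e \<in> E \<Longrightarrow> \<exists>x y. e = {x, y} \<and> x \<noteq> y \<and> x \<in> V \<and> y \<in> V"
  obtains f where "arborescence V f r" "tree_edges f = T"
proof -
  from assms(1) have TE: "T \<subseteq> E" and conn: "connected_graph V T" and acyc: "\<And>p. \<not> is_cycle V T p"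
    by (auto simp: spanning_tree_def is_tree_def)
  \<comment> \<open>\<open>n\<close> counts the vertices of a path, so \<open>d\<close> is the
    distance to \<open>r\<close> plus one; only comparisons of \<open>d\<close> matter.\<close>
  define P where "P x n \<longleftrightarrow> (\<exists>p. is_path V T p \<and> hd p = x \<and> last p = r \<and> length p = n)" for x n
  define d where "d x = (LEAST n. P x n)" for x
  have closer: "\<exists>y. {x, y} \<in> T \<and> y \<in> V \<and> d y < d x" if x: "x \<in> V" "x \<noteq> r" for x
  proof -
    have "\<exists>n. P x n"
      using conn x(1) assms(2) unfolding connected_graph_def P_def by blast
    then have "P x (d x)" unfolding d_def by (rule LeastI_ex)
    then obtain p where p: "is_path V T p" "hd p = x" "last p = r" "length p = d x"
      unfolding P_def by blast
    then obtain y p' where "p = x # y # p'"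
      using x(2) by (cases p; cases "tl p") (auto simp: is_path_def)
    with p have "is_path V T (y # p')" "{x, y} \<in> T" "last (y # p') = r" "length (y # p') < d x"
      by (auto simp: is_path_Cons_Cons)
    moreover from this have "P y (length (y # p'))" unfolding P_def by (metis list.sel(1))
    then have "d y \<le> length (y # p')" unfolding d_def by (rule Least_le)
    moreover have "y \<in> V" using \<open>is_path V T (y # p')\<close> by (simp add: is_path_def)
    ultimately show ?thesis by force
  qed
  then obtain g where g: "\<And>x. x \<in> V \<Longrightarrow> x \<noteq> r \<Longrightarrow> {x, g x} \<in> T \<and> g x \<in> V \<and> d (g x) < d x"
    by metis
  define f where "f x = (if x \<in> V \<and> x \<noteq> r then Some (g x) else None)" for x
  have f: "{x, y} \<in> T" "y \<in> V" "d y < d x" if "f x = Some y" for x y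
    using that g[of x] by (auto simp: f_def split: if_splits)
  interpret arborescence V f r
  proof
    show "wf (parent_rel f)"
      by (rule wf_subset[OF wf_measure[of d]]) (auto simp: parent_rel_def f)
    show "f x = None \<longleftrightarrow> x \<notin> V \<or> x = r" for x
      by (simp add: f_def)
  qed (use assms(2) f(2) in blast)+
  have sub: "tree_edges f \<subseteq> T"
    using f by (auto simp: tree_edges_def)
  have "T \<subseteq> tree_edges f"
  proof
    fix e assume "e \<in> T"
    then obtain u v where e: "e = {u, v}" "u \<noteq> v" "u \<in> V" "v \<in> V"
      using edges TE by blast
    show "e \<in> tree_edges f"
    proof (rule ccontr)
      assume "e \<notin> tree_edges f"
      obtain p where p: "is_path V (tree_edges f) p" "hd p = u" "last p = v"
        using connected e unfolding connected_graph_def by blast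
      \<comment> \<open>A shorter path from \<open>u\<close> to \<open>v\<close> would be a single
        vertex, against \<open>u \<noteq> v\<close>, or the missing edge \<open>e\<close>
        itself.\<close>
      have "length p \<ge> 3"
      proof (rule ccontr)
        assume "\<not> 3 \<le> length p"
        then have "p = [] \<or> p = [u] \<or> p = [u, v]"
          using p(2,3) by (cases p; cases "tl p"; cases "tl (tl p)") auto
        then show False
          using p(1) e(2) \<open>e \<notin> tree_edges f\<close> p(2,3) unfolding e(1)
          by (elim disjE) (simp_all add: is_path_def)
      qed
      moreover have "{last p, hd p} \<in> T" using \<open>e \<in> T\<close> e p by (simp add: insert_commute)
      ultimately show False
        using acyc[of p] is_path_mono[OF p(1) sub] by (simp add: is_cycle_def)
    qed
  qed
  with sub have "tree_edges f = T" by blast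
  then show ?thesis using that arborescence_axioms by blast
qed

text \<open>Injective because the edges oriented towards the root give the parent function back;
  surjective by \<open>spanning_tree_arborescence\<close>.\<close>

lemma bij_betw_arborescence_rooted_trees:
  fixes V :: "'v::finite set"
  assumes "\<And>e. e \<in> E \<Longrightarrow> \<exists>x y. e = {x, y} \<and> x \<noteq> y \<and> x \<in> V \<and> y \<in> V"
  shows "bij_betw (\<lambda>(f, r). (tree_edges f, r)) {(f, r). arborescence V f r \<and> tree_edges f \<subseteq> E}
    (rooted_spanning_trees V E)"
  unfolding bij_betw_def
proof
  show "inj_on (\<lambda>(f, r). (tree_edges f, r)) {(f, r). arborescence V f r \<and> tree_edges f \<subseteq> E}"
  proof (rule inj_onI, clarsimp)
    fix f g r assume "arborescence V f r" "arborescence V g r" "tree_edges f = tree_edges g"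
    then have "{(x, y). f x = Some y} = {(x, y). g x = Some y}"
      by (metis arborescence.oriented_edges)
    then have "f x = Some y \<longleftrightarrow> g x = Some y" for x y by (auto simp: set_eq_iff)
    then show "f = g" by (metis ext option.exhaust)
  qed
  show "(\<lambda>(f, r). (tree_edges f, r)) ` {(f, r). arborescence V f r \<and> tree_edges f \<subseteq> E} =
      rooted_spanning_trees V E"
  proof (intro equalityI subsetI)
    fix F assume "F \<in> (\<lambda>(f, r). (tree_edges f, r)) ` {(f, r). arborescence V f r \<and> tree_edges f \<subseteq> E}"
    then show "F \<in> rooted_spanning_trees V E"
      by (auto simp: rooted_spanning_trees_def intro: arborescence.spanning_tree arborescence.root)
  next
    fix F assume "F \<in> rooted_spanning_trees V E"
    then obtain T r where F: "F = (T, r)" "spanning_tree V E T" "r \<in> V"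
      by (auto simp: rooted_spanning_trees_def)
    obtain f where "arborescence V f r" "tree_edges f = T"
      using spanning_tree_arborescence[OF F(2,3) assms] by blast
    moreover have "T \<subseteq> E" using F(2) by (simp add: spanning_tree_def)
    ultimately show "F \<in> (\<lambda>(f, r). (tree_edges f, r)) ` {(f, r). arborescence V f r \<and> tree_edges f \<subseteq> E}"
      using F(1) by force
  qed
qed

lemma sum_rooted_spanning_trees:
  fixes V :: "'v::finite set"
  assumes "\<And>e. e \<in> E \<Longrightarrow> \<exists>x y. e = {x, y} \<and> x \<noteq> y \<and> x \<in> V \<and> y \<in> V"
  shows "(\<Sum>F\<in>rooted_spanning_trees V E. G (oriented_edges V F)) =
    (\<Sum>f | \<exists>r. arborescence V f r \<and> tree_edges f \<subseteq> E. G {(x, y). f x = Some y})"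
proof -
  let ?P = "{(f, r). arborescence V f r \<and> tree_edges f \<subseteq> E}"
  have "(\<Sum>F\<in>rooted_spanning_trees V E. G (oriented_edges V F)) =
      (\<Sum>z\<in>?P. G (oriented_edges V (tree_edges (fst z), snd z)))"
    using sum.reindex_bij_betw[OF bij_betw_arborescence_rooted_trees[OF assms],
        where g = "\<lambda>F. G (oriented_edges V F)"]
    by (simp add: case_prod_beta)
  also have "\<dots> = (\<Sum>z\<in>?P. G {(x, y). fst z x = Some y})"
    by (intro sum.cong) (auto simp: arborescence.oriented_edges)
  also have "\<dots> = (\<Sum>f\<in>fst ` ?P. G {(x, y). f x = Some y})"
  proof (subst sum.reindex)
    show "inj_on fst ?P"
      by (rule inj_onI, clarsimp) (metis arborescence.None_iff arborescence.root)
  qed simp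
  also have "fst ` ?P = {f. \<exists>r. arborescence V f r \<and> tree_edges f \<subseteq> E}"
    by force
  finally show ?thesis .
qed

section \<open>Counting covers in the subspace lattice\<close>

text \<open>Identities between q-integers are proved below after multiplication by
  \<open>q - 1\<close>, which turns them into identities between powers of \<open>q\<close>.\<close>

lemma q_int_times: "real (q_int q m) * (real q - 1) = real q ^ m - 1"
proof -
  have "real (q_int q m) = (\<Sum>i<m. real q ^ i)" by (simp add: q_int_def)
  then show ?thesis by (simp add: power_diff_1_eq mult.commute)
qed

lemma card_field_gt_1: "1 < CARD('a::{field,finite})"
proof -
  have "card {0, 1 :: 'a} \<le> CARD('a)" by (rule card_mono) auto
  then show ?thesis by simp
qed

text \<open>Each basis vector \<open>b\<close> multiplies the size by the order of the field, since
  \<open>k *s b + v\<close> determines \<open>k\<close> and \<open>v\<close> when \<open>b\<close>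
  is outside the span.\<close>

lemma card_subspace:
  fixes X :: "('a::{field,finite} ^ 'n) set"
  assumes "vec.subspace X"
  shows "card X = CARD('a) ^ vec.dim X"
proof -
  have *: "card (vec.span B) = CARD('a) ^ card B" if "finite B" "vec.independent B" for B :: "('a ^ 'n) set"
    using that
  proof (induction B)
    case empty
    then show ?case by simp
  next
    case (insert b B)
    then have b: "b \<notin> vec.span B" and ind: "vec.independent B"
      by (simp_all add: vec.independent_insert)
    let ?g = "\<lambda>(k, v). k *s b + v"
    have "inj_on ?g (UNIV \<times> vec.span B)"
    proof (rule inj_onI, clarify)
      fix k v l u assume vu: "v \<in> vec.span B" "u \<in> vec.span B" and eq: "k *s b + v = l *s b + u"
      have "k = l"
      proof (rule ccontr)
        assume "k \<noteq> l"
        have "(k - l) *s b = u - v"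
          using eq by (simp add: algebra_simps)
        also have "\<dots> \<in> vec.span B" using vu by (simp add: vec.span_diff)
        finally have "inverse (k - l) *s ((k - l) *s b) \<in> vec.span B"
          by (rule vec.span_scale)
        with b \<open>k \<noteq> l\<close> show False by simp
      qed
      with eq show "k = l \<and> v = u" by simp
    qed
    then have "card (?g ` (UNIV \<times> vec.span B)) = CARD('a) * card (vec.span B)"
      by (simp add: card_image card_cartesian_product)
    moreover have "?g ` (UNIV \<times> vec.span B) = vec.span (insert b B)"
    proof (intro equalityI subsetI)
      fix x assume "x \<in> vec.span (insert b B)"
      then obtain k where "x - k *s b \<in> vec.span B" by (auto simp: vec.span_insert)
      then show "x \<in> ?g ` (UNIV \<times> vec.span B)"
        by (intro image_eqI[of _ _ "(k, x - k *s b)"]) auto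
    next
      fix x assume "x \<in> ?g ` (UNIV \<times> vec.span B)"
      then obtain k v where "v \<in> vec.span B" "x = k *s b + v" by auto
      then show "x \<in> vec.span (insert b B)"
        unfolding vec.span_insert by (auto intro!: exI[of _ k])
    qed
    ultimately show ?case using insert.IH[OF ind] insert.hyps by simp
  qed
  obtain B where B: "B \<subseteq> X" "vec.independent B" "X \<subseteq> vec.span B" "card B = vec.dim X"
    using vec.basis_exists .
  then have "vec.span B = X"
    using assms vec.span_minimal by blast
  then show ?thesis using *[of B] B vec.finiteI_independent by auto
qed

section \<open>The covering relation and its counts\<close>

text \<open>False unless both sets are subspaces, so that sums over all sets of vectors see only the
  lattice.\<close>

definition covered :: "('a::{field,finite} ^ 'n) set \<Rightarrow> ('a ^ 'n) set \<Rightarrow> bool" where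
  "covered X Y \<longleftrightarrow> vec.subspace X \<and> vec.subspace Y \<and> X \<subseteq> Y \<and> vec.dim Y = vec.dim X + 1"

lemma coveredD:
  assumes "covered X Y"
  shows "vec.subspace X" "vec.subspace Y" "X \<subseteq> Y" "vec.dim Y = vec.dim X + 1"
  using assms by (simp_all add: covered_def)

lemma span_insert_covered:
  assumes "vec.subspace X" "v \<notin> X"
  shows "covered X (vec.span (insert v X))"
proof -
  have "X \<subseteq> vec.span (insert v X)"
    by (meson subset_insertI subset_trans vec.span_superset)
  moreover have "v \<notin> vec.span X" using assms by (simp add: vec.span_eq_iff[THEN iffD2])
  ultimately show ?thesis using assms by (simp add: covered_def vec.dim_insert)
qed

text \<open>Any vector of \<open>Y\<close> outside \<open>X\<close> determines the cover; hence the
  differences \<open>Y - X\<close> of distinct covers are disjoint.\<close>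

lemma covered_eq_span_insert:
  assumes "covered X Y" "v \<in> Y" "v \<notin> X"
  shows "Y = vec.span (insert v X)"
proof -
  have "covered X (vec.span (insert v X))"
    using assms span_insert_covered coveredD by blast
  moreover have "vec.span (insert v X) \<subseteq> Y"
    using assms by (intro vec.span_minimal) (auto dest: coveredD)
  ultimately show ?thesis
    using assms(1) vec.subspace_dim_equal[of "vec.span (insert v X)" Y] by (simp add: covered_def)
qed

lemma card_subspace_Diff:
  fixes X :: "('a::{field,finite} ^ 'n) set"
  assumes "vec.subspace X" "vec.subspace Y" "X \<subseteq> Y"
  shows "real (card (Y - X)) = real CARD('a) ^ vec.dim Y - real CARD('a) ^ vec.dim X"
proof -
  have "card X \<le> card Y" using assms by (intro card_mono) auto
  then show ?thesis
    using assms by (simp add: card_Diff_subset card_subspace)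
qed

text \<open>The differences \<open>Y - X\<close> partition the complement of \<open>X\<close> into
  blocks of equal size \<open>q^k (q - 1)\<close>, where \<open>k\<close> is the dimension of
  \<open>X\<close>.\<close>

lemma card_covers:
  fixes X :: "('a::{field,finite} ^ 'n) set"
  assumes "vec.subspace X"
  shows "card {Y. covered X Y} = q_int CARD('a) (CARD('n) - vec.dim X)"
proof -
  let ?q = "real CARD('a)" and ?k = "vec.dim X"
  have le: "?k \<le> CARD('n)"
    using vec.dim_subset[of X UNIV] unfolding vec_dim_card by simp
  have "- X = (\<Union>Y\<in>{Y. covered X Y}. Y - X)"
    using span_insert_covered[OF assms] vec.span_base[OF insertI1] by blast
  then have "card (- X) = card (\<Union>Y\<in>{Y. covered X Y}. Y - X)"
    by (rule arg_cong)
  also have "\<dots> = (\<Sum>Y | covered X Y. card (Y - X))"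
  proof (intro card_UN_disjoint ballI impI)
    fix Y Y' assume "Y \<in> {Y. covered X Y}" "Y' \<in> {Y. covered X Y}" "Y \<noteq> Y'"
    then show "(Y - X) \<inter> (Y' - X) = {}" using covered_eq_span_insert by blast
  qed auto
  finally have "real (card (UNIV - X)) = (\<Sum>Y | covered X Y. real (card (Y - X)))"
    by (simp add: Compl_eq_Diff_UNIV)
  also have "(\<Sum>Y | covered X Y. real (card (Y - X))) = (\<Sum>Y | covered X Y. ?q ^ (?k + 1) - ?q ^ ?k)"
    by (intro sum.cong refl) (auto simp: card_subspace_Diff covered_def)
  also have "real (card (UNIV - X)) = ?q ^ CARD('n) - ?q ^ ?k"
    using card_subspace_Diff[OF assms vec.subspace_UNIV subset_UNIV] unfolding vec_dim_card .
  finally have "?q ^ CARD('n) - ?q ^ ?k = real (card {Y. covered X Y}) * (?q ^ ?k * (?q - 1))"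
    by (simp add: algebra_simps)
  moreover have "?q ^ CARD('n) = ?q ^ ?k * ?q ^ (CARD('n) - ?k)"
    using le by (simp flip: power_add)
  ultimately have "?q ^ ?k * (real (card {Y. covered X Y}) * (?q - 1)) = ?q ^ ?k * (?q ^ (CARD('n) - ?k) - 1)"
    by (simp add: algebra_simps)
  then have "real (card {Y. covered X Y}) * (?q - 1) = real (q_int CARD('a) (CARD('n) - ?k)) * (?q - 1)"
    unfolding q_int_times by simp
  then show ?thesis using card_field_gt_1[where 'a = 'a] by simp
qed

text \<open>
  Induction on the codimension of \<open>Z\<close>, counting pairs of a hyperplane \<open>Y \<supseteq> Z\<close> of \<open>X\<close> and a vector
  \<open>v \<in> Y - Z\<close>. Codimension one has to be treated apart, since then there are no such pairs.
\<close>

lemma card_covered_above: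
  fixes X Z :: "('a::{field,finite} ^ 'n) set"
  assumes "vec.subspace X" "vec.subspace Z" "Z \<subseteq> X"
  shows "card {Y. covered Y X \<and> Z \<subseteq> Y} = q_int CARD('a) (vec.dim X - vec.dim Z)"
  using assms(2,3)
proof (induction "vec.dim X - vec.dim Z" arbitrary: Z)
  case 0
  have "\<not> Z \<subseteq> Y" if "covered Y X" for Y
    using that 0(1) vec.dim_subset[of Z Y] by (auto simp: covered_def)
  then have "{Y. covered Y X \<and> Z \<subseteq> Y} = {}" by blast
  then show ?case using 0(1) by (simp add: q_int_def)
next
  case (Suc m)
  let ?q = "real CARD('a)" and ?H = "{Y. covered Y X \<and> Z \<subseteq> Y}"
  show ?case
  proof (cases "m = 0")
    case True
    then have dim: "vec.dim X = vec.dim Z + 1" using Suc(2) by simp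
    have "Y = Z" if "covered Y X" "Z \<subseteq> Y" for Y
      using vec.subspace_dim_equal[of Z Y] that dim Suc.prems by (auto simp: covered_def)
    moreover have "covered Z X" using dim assms(1) Suc.prems by (simp add: covered_def)
    ultimately have "?H = {Z}" by auto
    then show ?thesis using dim by (simp add: q_int_def)
  next
    case False
    \<comment> \<open>The hyperplanes of \<open>X\<close> containing \<open>Z\<close> and
      \<open>v\<close> are those above the span of both, whose codimension is one less.\<close>
    have avoid: "card {Y \<in> ?H. v \<in> Y} = q_int CARD('a) m" if v: "v \<in> X - Z" for v
    proof -
      have c: "covered Z (vec.span (insert v Z))"
        using span_insert_covered Suc.prems(1) v by blast
      have sub: "vec.span (insert v Z) \<subseteq> Y \<longleftrightarrow> v \<in> Y \<and> Z \<subseteq> Y" if "vec.subspace Y" for Y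
        using that vec.span_minimal[of "insert v Z" Y] vec.span_superset[of "insert v Z"] by blast
      have "{Y \<in> ?H. v \<in> Y} = {Y. covered Y X \<and> vec.span (insert v Z) \<subseteq> Y}"
        using sub by (auto dest: coveredD)
      moreover have "vec.dim X - vec.dim (vec.span (insert v Z)) = m"
        using Suc(2) coveredD(4)[OF c] by simp
      ultimately show ?thesis
        using Suc(1)[of "vec.span (insert v Z)"] sub[OF assms(1)] v Suc.prems(2) by simp
    qed
    have dim: "vec.dim X = Suc (vec.dim Z + m)" using Suc(2) by simp
    have "(\<Sum>Y\<in>?H. card (Y - Z)) = (\<Sum>Y\<in>?H. card {v \<in> X - Z. v \<in> Y})"
      by (intro sum.cong refl arg_cong[of _ _ card]) (auto dest: coveredD)
    also have "\<dots> = (\<Sum>v\<in>X - Z. card {Y \<in> ?H. v \<in> Y})"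
      by (rule sum_multicount_gen) auto
    also have "\<dots> = card (X - Z) * q_int CARD('a) m"
      using avoid by simp
    finally have "real (\<Sum>Y\<in>?H. card (Y - Z)) = real (card (X - Z) * q_int CARD('a) m)"
      by (rule arg_cong)
    then have "(\<Sum>Y\<in>?H. real (card (Y - Z))) = real (card (X - Z)) * real (q_int CARD('a) m)"
      unfolding of_nat_sum of_nat_mult .
    also have "real (card (X - Z)) = ?q ^ vec.dim Z * (?q ^ Suc m - 1)"
      using card_subspace_Diff[OF Suc.prems(1) assms(1) Suc.prems(2)] dim
      by (simp add: power_add algebra_simps)
    also have "(\<Sum>Y\<in>?H. real (card (Y - Z))) = (\<Sum>Y\<in>?H. ?q ^ vec.dim Z * (?q ^ m - 1))"
    proof (intro sum.cong refl)
      fix Y assume Y: "Y \<in> ?H"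
      then have dY: "vec.dim Y = vec.dim Z + m" using dim by (auto simp: covered_def)
      from Y show "real (card (Y - Z)) = ?q ^ vec.dim Z * (?q ^ m - 1)"
        using card_subspace_Diff[of Z Y] Suc.prems
        by (simp add: covered_def power_add algebra_simps dY)
    qed
    also have "\<dots> = ?q ^ vec.dim Z * ((?q ^ m - 1) * real (card ?H))"
      by simp
    finally have "(?q ^ m - 1) * real (card ?H) = (?q ^ Suc m - 1) * real (q_int CARD('a) m)"
      using card_field_gt_1[where 'a = 'a] by (simp only: mult.assoc) simp
    then have "(?q ^ m - 1) * real (card ?H) * (?q - 1) =
        (?q ^ Suc m - 1) * real (q_int CARD('a) m) * (?q - 1)"
      by (rule arg_cong)
    then have "(?q ^ m - 1) * (real (card ?H) * (?q - 1)) =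
        (?q ^ m - 1) * (real (q_int CARD('a) (Suc m)) * (?q - 1))"
      unfolding mult.assoc q_int_times by (simp only: mult.commute)
    \<comment> \<open>This is where \<open>m \<noteq> 0\<close> enters: it permits cancelling
      \<open>?q ^ m - 1\<close>.\<close>
    moreover have "?q ^ m \<noteq> 1"
      using one_less_power[of ?q m] card_field_gt_1[where 'a = 'a] False
      by (metis less_irrefl neq0_conv of_nat_1 of_nat_less_iff)
    ultimately show ?thesis
      using card_field_gt_1[where 'a = 'a] dim by simp
  qed
qed

text \<open>The only candidate is the sum of \<open>X\<close> and \<open>Z\<close>. By the dimension
  formula it covers \<open>X\<close> exactly when \<open>X \<inter> Z\<close> is a hyperplane of
  \<open>Z\<close>.\<close>

lemma card_covers_not_below:
  fixes X Z :: "('a::{field,finite} ^ 'n) set"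
  assumes X: "vec.subspace X" and Z: "vec.subspace Z" and "\<not> Z \<subseteq> X"
  shows "card {Y. covered X Y \<and> Z \<subseteq> Y} = (if vec.dim (X \<inter> Z) + 1 = vec.dim Z then 1 else 0)"
proof -
  define S where "S = {x + y |x y. x \<in> X \<and> y \<in> Z}"
  have S: "vec.subspace S" unfolding S_def using X Z by (rule vec.subspace_sums)
  have dim: "vec.dim S + vec.dim (X \<inter> Z) = vec.dim X + vec.dim Z"
    unfolding S_def using X Z by (rule vec.dim_sums_Int)
  have XS: "X \<subseteq> S" "Z \<subseteq> S"
    unfolding S_def using vec.subspace_0[OF X] vec.subspace_0[OF Z] by force+
  have least: "S \<subseteq> Y" if "vec.subspace Y" "X \<subseteq> Y" "Z \<subseteq> Y" for Y
    unfolding S_def using that vec.subspace_add by blast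
  have "vec.dim X < vec.dim S"
    using vec.subspace_dim_equal[OF X S XS(1)] XS(2) assms(3) by force
  then have "Y = S" if "covered X Y" "Z \<subseteq> Y" for Y
    using vec.subspace_dim_equal[OF S, of Y] least[of Y] that by (auto simp: covered_def)
  moreover have "covered X S \<longleftrightarrow> vec.dim (X \<inter> Z) + 1 = vec.dim Z"
    using X S XS dim by (auto simp: covered_def)
  ultimately have "{Y. covered X Y \<and> Z \<subseteq> Y} = (if vec.dim (X \<inter> Z) + 1 = vec.dim Z then {S} else {})"
    using XS by auto
  then show ?thesis by simp
qed

text \<open>The only candidate is \<open>X \<inter> Z\<close>. The count agrees with that of
  \<open>card_covers_not_below\<close>, which makes the entries with \<open>Z\<close> not below
  \<open>X\<close> cancel.\<close>

lemma card_covered_below: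
  fixes X Z :: "('a::{field,finite} ^ 'n) set"
  assumes X: "vec.subspace X" and Z: "vec.subspace Z" and "\<not> Z \<subseteq> X"
  shows "card {W. covered W Z \<and> W \<subseteq> X} = (if vec.dim (X \<inter> Z) + 1 = vec.dim Z then 1 else 0)"
proof -
  have I: "vec.subspace (X \<inter> Z)" using X Z by (rule vec.subspace_inter)
  have "vec.dim (X \<inter> Z) < vec.dim Z"
    using vec.subspace_dim_equal[OF I Z] assms(3) by force
  then have "W = X \<inter> Z" if "covered W Z" "W \<subseteq> X" for W
    using vec.subspace_dim_equal[of W "X \<inter> Z"] that I by (auto simp: covered_def)
  moreover have "covered (X \<inter> Z) Z \<longleftrightarrow> vec.dim (X \<inter> Z) + 1 = vec.dim Z"
    using I Z by (auto simp: covered_def)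
  ultimately have "{W. covered W Z \<and> W \<subseteq> X} = (if vec.dim (X \<inter> Z) + 1 = vec.dim Z then {X \<inter> Z} else {})"
    by auto
  then show ?thesis by simp
qed

section \<open>The spectrum of the weighted Laplacian\<close>

lemma dim_le: "vec.dim (X :: ('a::field ^ 'n) set) \<le> CARD('n)"
  using vec.dim_subset[of X UNIV] unfolding vec_dim_card by simp

lemma mem_Cq_edges_iff: "{X, Y} \<in> Cq_edges \<longleftrightarrow> covered X Y \<or> covered Y X"
  by (auto simp: Cq_edges_def Cq_verts_def covered_def doubleton_eq_iff)

definition up_down :: "('a::{field,finite} ^ 'n) set \<Rightarrow> ('a ^ 'n) set \<Rightarrow> real" where
  "up_down X Y = (if covered X Y then real CARD('a) ^ vec.dim X else if covered Y X then 1 else 0)"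

lemma sum_up_down:
  fixes X :: "('a::{field,finite} ^ 'n) set"
  shows "(\<Sum>Y\<in>UNIV. up_down X Y * g Y) =
    real CARD('a) ^ vec.dim X * (\<Sum>Y | covered X Y. g Y) + (\<Sum>Y | covered Y X. g Y)"
proof -
  have "(\<Sum>Y\<in>UNIV. up_down X Y * g Y) =
      (\<Sum>Y\<in>UNIV. (if covered X Y then real CARD('a) ^ vec.dim X * g Y else 0) +
        (if covered Y X then g Y else 0))"
    by (intro sum.cong) (auto simp: up_down_def covered_def)
  also have "\<dots> = (\<Sum>Y | covered X Y. real CARD('a) ^ vec.dim X * g Y) + (\<Sum>Y | covered Y X. g Y)"
    by (simp add: sum.distrib sum.If_cases)
  finally show ?thesis by (simp add: sum_distrib_left)
qed

lemma q_int_add: "real (q_int q (m + k)) = real (q_int q m) + real q ^ m * real (q_int q k)"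
  by (induction k) (simp_all add: q_int_def power_add algebra_simps)

text \<open>With \<open>k\<close> the dimension of \<open>X\<close>, the hyperplanes contribute
  \<open>(k)_q\<close> and the covers \<open>q^k (n-k)_q\<close>, together \<open>(n)_q\<close>. So
  on subspaces the Laplacian is a scalar minus the adjacency matrix.\<close>

lemma sum_up_down_const:
  fixes X :: "('a::{field,finite} ^ 'n) set"
  assumes "vec.subspace X"
  shows "(\<Sum>Y\<in>UNIV. up_down X Y) = real (q_int CARD('a) CARD('n))"
proof -
  have "card {Y. covered Y X} = q_int CARD('a) (vec.dim X)"
    using card_covered_above[OF assms, of "{0}"] vec.subspace_0[OF assms]
    by (simp add: covered_def vec.subspace_0 cong: conj_cong)
  then show ?thesis
    using sum_up_down[of X "\<lambda>_. 1"] card_covers[OF assms] dim_le[of X]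
      q_int_add[of "CARD('a)" "vec.dim X" "CARD('n) - vec.dim X"]
    by simp
qed

text \<open>The base of the k-th factor in the product formula; it vanishes at
  \<open>k = 0\<close>.\<close>

definition eigenvalue :: "nat \<Rightarrow> nat \<Rightarrow> nat \<Rightarrow> real" where
  "eigenvalue q n k = real ((1 + q ^ (n - k)) * q_int q k)"

text \<open>The zeta matrix of the lattice, twisted by powers of \<open>q\<close>.\<close>

definition zeta :: "('a::{field,finite} ^ 'n) set \<Rightarrow> ('a ^ 'n) set \<Rightarrow> real" where
  "zeta X Z = (if Z \<subseteq> X then real CARD('a) ^ (vec.dim Z * (CARD('n) - vec.dim X)) else 0)"

text \<open>If \<open>Z\<close> lies in \<open>X\<close>, every count is a q-integer and dividing by
  \<open>zeta X Z\<close> leaves an identity between q-integers. Otherwise \<open>zeta X Z\<close>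
  vanishes and the two remaining terms have equal counts and equal exponents.\<close>

lemma zeta_triangularises:
  fixes X Z :: "('a::{field,finite} ^ 'n) set"
  assumes X: "vec.subspace X" and Z: "vec.subspace Z"
  shows "real (q_int CARD('a) CARD('n)) * zeta X Z - (\<Sum>Y\<in>UNIV. up_down X Y * zeta Y Z) =
    eigenvalue CARD('a) CARD('n) (vec.dim Z) * zeta X Z
      - real CARD('a) ^ (CARD('n) - vec.dim Z) * (\<Sum>W | covered W Z. zeta X W)"
proof -
  let ?q = "real CARD('a)" and ?n = "CARD('n)"
  define k j z where "k = vec.dim X" and "j = ?n - vec.dim X" and "z = vec.dim Z"
  have n: "?n = k + j" using dim_le[of X] by (simp add: k_def j_def)
  have zn: "z \<le> ?n" using dim_le[of Z] by (simp add: z_def)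
  have up: "(\<Sum>Y | covered X Y. zeta Y Z) = ?q ^ (z * (j - 1)) * real (card {Y. covered X Y \<and> Z \<subseteq> Y})"
  proof -
    have "(\<Sum>Y | covered X Y. zeta Y Z) = (\<Sum>Y | covered X Y. if Z \<subseteq> Y then ?q ^ (z * (j - 1)) else 0)"
      by (intro sum.cong) (auto simp: zeta_def covered_def z_def j_def)
    also have "\<dots> = (\<Sum>Y | covered X Y \<and> Z \<subseteq> Y. ?q ^ (z * (j - 1)))"
      by (simp add: sum.If_cases Int_def)
    finally show ?thesis by simp
  qed
  have down: "(\<Sum>Y | covered Y X. zeta Y Z) = ?q ^ (z * (j + 1)) * real (card {Y. covered Y X \<and> Z \<subseteq> Y})"
  proof -
    have "(\<Sum>Y | covered Y X. zeta Y Z) = (\<Sum>Y | covered Y X. if Z \<subseteq> Y then ?q ^ (z * (j + 1)) else 0)"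
    proof (intro sum.cong refl)
      fix Y assume "Y \<in> {Y. covered Y X}"
      then have "?n - vec.dim Y = j + 1"
        using n by (simp add: covered_def k_def)
      then show "zeta Y Z = (if Z \<subseteq> Y then ?q ^ (z * (j + 1)) else 0)"
        by (simp add: zeta_def z_def)
    qed
    also have "\<dots> = (\<Sum>Y | covered Y X \<and> Z \<subseteq> Y. ?q ^ (z * (j + 1)))"
      by (simp add: sum.If_cases Int_def)
    finally show ?thesis by simp
  qed
  have below: "(\<Sum>W | covered W Z. zeta X W) = ?q ^ ((z - 1) * j) * real (card {W. covered W Z \<and> W \<subseteq> X})"
  proof -
    have "(\<Sum>W | covered W Z. zeta X W) = (\<Sum>W | covered W Z. if W \<subseteq> X then ?q ^ ((z - 1) * j) else 0)"
      by (intro sum.cong) (auto simp: zeta_def covered_def z_def j_def)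
    also have "\<dots> = (\<Sum>W | covered W Z \<and> W \<subseteq> X. ?q ^ ((z - 1) * j))"
      by (simp add: sum.If_cases Int_def)
    finally show ?thesis by simp
  qed
  show ?thesis
  proof (cases "Z \<subseteq> X")
    case True
    define i where "i = k - z"
    have k: "k = z + i"
      using vec.dim_subset[OF True] by (simp add: i_def k_def z_def)
    have N1: "{Y. covered X Y \<and> Z \<subseteq> Y} = {Y. covered X Y}"
      using True by (auto simp: covered_def)
    \<comment> \<open>The condition on \<open>{0}\<close> is automatic; it turns all hyperplanes of
      \<open>Z\<close> into an instance of \<open>card_covered_above\<close>.\<close>
    have N3: "{W. covered W Z \<and> W \<subseteq> X} = {W. covered W Z \<and> {0} \<subseteq> W}"
      using True by (auto simp: covered_def vec.subspace_0)
    have zero: "vec.subspace {0 :: 'a ^ 'n}" "{0} \<subseteq> Z"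
      using vec.subspace_0[OF Z] by auto
    have c: "card {Y. covered X Y \<and> Z \<subseteq> Y} = q_int CARD('a) j"
      "card {Y. covered Y X \<and> Z \<subseteq> Y} = q_int CARD('a) i"
      "card {W. covered W Z \<and> W \<subseteq> X} = q_int CARD('a) z"
      unfolding N1 N3 card_covers[OF X] card_covered_above[OF X Z True] card_covered_above[OF Z zero]
      by (simp_all add: j_def i_def k_def z_def)
    \<comment> \<open>The truncated \<open>j - 1\<close> at \<open>j = 0\<close> does no harm,
      because the q-integer beside it is then 0; likewise for \<open>z - 1\<close> in
      \<open>e2\<close>.\<close>
    have e1: "?q ^ k * (?q ^ (z * (j - 1)) * real (q_int CARD('a) j)) =
        ?q ^ (z * j) * (?q ^ i * real (q_int CARD('a) j))"
    proof (cases j)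
      case (Suc j')
      then show ?thesis by (simp add: k power_add algebra_simps)
    qed (simp add: q_int_def)
    have e2: "?q ^ (i + j) * (?q ^ ((z - 1) * j) * real (q_int CARD('a) z)) =
        ?q ^ (z * j) * (?q ^ i * real (q_int CARD('a) z))"
    proof (cases z)
      case (Suc z')
      then show ?thesis by (simp add: power_add algebra_simps)
    qed (simp add: q_int_def)
    have e3: "?q ^ (z * (j + 1)) = ?q ^ (z * j) * ?q ^ z"
      by (simp add: power_add)
    have nz: "?n - z = i + j" and n': "?n = z + i + j" using n k by simp_all
    have zXZ: "zeta X Z = ?q ^ (z * j)"
      using True by (simp add: zeta_def z_def j_def)
    have "(real (q_int CARD('a) (z + i + j)) - ?q ^ i * real (q_int CARD('a) j)
        - ?q ^ z * real (q_int CARD('a) i)) * (?q - 1) =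
      (eigenvalue CARD('a) (z + i + j) z - ?q ^ i * real (q_int CARD('a) z)) * (?q - 1)"
      unfolding eigenvalue_def left_diff_distrib of_nat_mult mult.assoc q_int_times
      by (simp add: power_add algebra_simps)
    then have "real (q_int CARD('a) (z + i + j)) - ?q ^ i * real (q_int CARD('a) j)
        - ?q ^ z * real (q_int CARD('a) i) =
      eigenvalue CARD('a) (z + i + j) z - ?q ^ i * real (q_int CARD('a) z)"
      using card_field_gt_1[where 'a = 'a] by simp
    then have "?q ^ (z * j) * (real (q_int CARD('a) ?n) - ?q ^ i * real (q_int CARD('a) j)
        - ?q ^ z * real (q_int CARD('a) i)) =
      ?q ^ (z * j) * (eigenvalue CARD('a) ?n z - ?q ^ i * real (q_int CARD('a) z))"
      unfolding n' by (rule arg_cong)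
    then show ?thesis
      unfolding sum_up_down up down below c zXZ e3 k_def[symmetric] z_def[symmetric] nz e1 e2
      by (simp add: algebra_simps)
  next
    case False
    have "card {Y. covered Y X \<and> Z \<subseteq> Y} = 0"
      using False by (auto simp: covered_def)
    moreover have "?q ^ k * ?q ^ (z * (j - 1)) = ?q ^ (?n - z) * ?q ^ ((z - 1) * j)"
      if "vec.dim (X \<inter> Z) + 1 = vec.dim Z"
    proof -
      \<comment> \<open>\<open>X\<close> is proper since \<open>Z\<close> is not inside it, so its
        codimension \<open>j\<close> is positive and \<open>j - 1\<close> a true
        subtraction.\<close>
      have "X \<noteq> UNIV" using False by auto
      then have "k \<noteq> ?n"
        using vec.subspace_dim_equal[OF X vec.subspace_UNIV] unfolding vec_dim_card k_def by auto
      then obtain j' where j': "j = Suc j'" using n by (cases j) auto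
      have z': "z = Suc (vec.dim (X \<inter> Z))" using that by (simp add: z_def)
      have "k + z * (j - 1) = (?n - z) + (z - 1) * j"
        using zn by (simp add: n j' z' algebra_simps)
      then show ?thesis by (simp flip: power_add)
    qed
    ultimately show ?thesis
      using False unfolding sum_up_down up down below
        card_covers_not_below[OF X Z False] card_covered_below[OF X Z False]
      by (simp add: zeta_def k_def z_def)
  qed
qed

text \<open>
  The matrix is indexed by all sets of vectors; at the sets that are not subspaces it is the
  identity.
\<close>

lemma det_up_down_laplacian:
  fixes t :: real
  shows "det ((\<chi> X Y. (if X = Y then (if vec.subspace X then t else 1) + (\<Sum>Z\<in>UNIV. up_down X Z) else 0)
      - up_down X Y) :: real ^ ('a::{field,finite} ^ 'n) set ^ ('a ^ 'n) set) =
    (\<Prod>Z :: ('a ^ 'n) set | vec.subspace Z. t + eigenvalue CARD('a) CARD('n) (vec.dim Z))"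
    (is "det ?L0 = _")
proof -
  define L where "L = ?L0"
  define M :: "real ^ ('a ^ 'n) set ^ ('a ^ 'n) set" where
    "M = (\<chi> X Z. if vec.subspace X \<and> vec.subspace Z then zeta X Z else if X = Z then 1 else 0)"
  \<comment> \<open>\<open>T\<close> collects the coefficients on the right of
    \<open>zeta_triangularises\<close>, so that \<open>L ** M = M ** T\<close>.\<close>
  define T :: "real ^ ('a ^ 'n) set ^ ('a ^ 'n) set" where
    "T = (\<chi> W Z. (if W = Z then if vec.subspace Z then t + eigenvalue CARD('a) CARD('n) (vec.dim Z) else 1 else 0)
      - (if covered W Z then real CARD('a) ^ (CARD('n) - vec.dim Z) else 0))"
  have irr: "\<not> covered X X" for X :: "('a ^ 'n) set" by (simp add: covered_def)
  have "(L ** M) $ X $ Z = (M ** T) $ X $ Z" for X Z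
  proof -
    have LM: "(L ** M) $ X $ Z = ((if vec.subspace X then t else 1) + (\<Sum>Y\<in>UNIV. up_down X Y)) * M $ X $ Z
        - (\<Sum>Y\<in>UNIV. up_down X Y * M $ Y $ Z)"
      by (simp add: matrix_matrix_mult_def L_def left_diff_distrib sum_subtractf
          if_distrib[where f = "\<lambda>u. u * _"] cong: if_cong)
    have MT: "(M ** T) $ X $ Z =
        M $ X $ Z * (if vec.subspace Z then t + eigenvalue CARD('a) CARD('n) (vec.dim Z) else 1)
        - real CARD('a) ^ (CARD('n) - vec.dim Z) * (\<Sum>W | covered W Z. M $ X $ W)"
      by (simp add: matrix_matrix_mult_def T_def right_diff_distrib sum_subtractf sum.If_cases
          if_distrib[where f = "\<lambda>u. _ * u"] mult.commute cong: if_cong flip: sum_distrib_right)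
    consider "vec.subspace X" "vec.subspace Z" | "\<not> vec.subspace X" | "\<not> vec.subspace Z" by blast
    then show ?thesis
    proof cases
      case 1
      have a: "(\<Sum>Y\<in>UNIV. up_down X Y * M $ Y $ Z) = (\<Sum>Y\<in>UNIV. up_down X Y * zeta Y Z)"
        using 1 by (intro sum.cong) (auto simp: M_def up_down_def covered_def)
      have b: "(\<Sum>W | covered W Z. M $ X $ W) = (\<Sum>W | covered W Z. zeta X W)"
        using 1 by (intro sum.cong) (auto simp: M_def covered_def)
      have c: "M $ X $ Z = zeta X Z" using 1 by (simp add: M_def)
      show ?thesis
        unfolding LM MT a b c sum_up_down_const[OF 1(1)]
        using zeta_triangularises[OF 1] 1 by (simp add: algebra_simps)
    next
      case 2
      then have "up_down X Y = 0" for Y by (simp add: up_down_def covered_def)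
      moreover have "(\<Sum>W | covered W Z. M $ X $ W) = 0"
        using 2 by (intro sum.neutral) (auto simp: M_def covered_def)
      ultimately show ?thesis
        unfolding LM MT using 2 by (auto simp: M_def)
    next
      case 3
      have "(\<Sum>Y\<in>UNIV. up_down X Y * M $ Y $ Z) = 0"
        using 3 by (intro sum.neutral) (auto simp: M_def up_down_def covered_def)
      moreover have "{W. covered W Z} = {}" "\<And>Y. up_down Z Y = 0"
        using 3 by (auto simp: covered_def up_down_def)
      ultimately show ?thesis
        unfolding LM MT using 3 by (auto simp: M_def)
    qed
  qed
  then have "L ** M = M ** T" by (simp add: vec_eq_iff)
  then have "det L * det M = det M * det T" by (metis det_mul)
  \<comment> \<open>\<open>M\<close> is triangular by codimension with powers of \<open>q\<close> or
    1 on the diagonal; hence \<open>det M\<close> cancels.\<close>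
  moreover have "det M = (\<Prod>X\<in>UNIV. M $ X $ X)"
  proof (rule det_triangular[where h = "\<lambda>X. CARD('n) - vec.dim X"])
    fix X Z assume "M $ X $ Z \<noteq> 0"
    then have "X = Z \<or> vec.subspace X \<and> vec.subspace Z \<and> Z \<subseteq> X"
      by (auto simp: M_def zeta_def split: if_splits)
    then show "X = Z \<or> CARD('n) - vec.dim X < CARD('n) - vec.dim Z"
      using vec.subspace_dim_equal[of Z X] dim_le[of X] by force
  qed
  then have "det M \<noteq> 0" by (simp add: M_def zeta_def)
  moreover have "det T = (\<Prod>Z\<in>UNIV. T $ Z $ Z)"
    by (rule det_triangular[where h = "vec.dim"]) (auto simp: T_def covered_def split: if_splits)
  ultimately have "det L = (\<Prod>Z\<in>UNIV. T $ Z $ Z)" by simp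
  also have "\<dots> = (\<Prod>Z :: ('a ^ 'n) set | vec.subspace Z. t + eigenvalue CARD('a) CARD('n) (vec.dim Z))"
    by (simp add: T_def irr prod.If_cases)
  finally show ?thesis by (simp only: L_def)
qed

section \<open>Extracting the forests with one root\<close>

text \<open>The factor \<open>g 0\<close> is split off because it becomes \<open>t\<close>; its
  exponent is 1, the zero subspace being the only one of dimension 0.\<close>

lemma prod_subspaces_by_dim:
  fixes g :: "nat \<Rightarrow> 'b::comm_monoid_mult"
  shows "(\<Prod>Z :: ('a::{field,finite} ^ 'n) set | vec.subspace Z. g (vec.dim Z)) =
    g 0 * (\<Prod>k=1..CARD('n). g k ^ q_binomial TYPE('a ^ 'n) k)"
proof -
  have "{X :: ('a ^ 'n) set. vec.subspace X \<and> vec.dim X = 0} = {{0}}"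
    by (auto simp: vec.subspace_0)
  then have b0: "q_binomial TYPE('a ^ 'n) 0 = 1" by (simp add: q_binomial_def)
  have "(\<Prod>Z :: ('a ^ 'n) set | vec.subspace Z. g (vec.dim Z)) =
      (\<Prod>k\<in>{0..CARD('n)}. \<Prod>Z\<in>{Z \<in> {Z :: ('a ^ 'n) set. vec.subspace Z}. vec.dim Z = k}. g (vec.dim Z))"
    by (rule prod.group[symmetric]) (auto simp: dim_le)
  also have "\<dots> = (\<Prod>k\<in>{0..CARD('n)}. g k ^ q_binomial TYPE('a ^ 'n) k)"
    by (intro prod.cong refl) (simp add: q_binomial_def)
  finally show ?thesis
    by (simp add: prod.atLeast_Suc_atMost b0)
qed

text \<open>Defined for every parent function and zero as soon as some vertex has a parent that is
  not a neighbour in the lattice graph.\<close>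

definition parent_weight :: "(('a::{field,finite} ^ 'n) set \<Rightarrow> ('a ^ 'n) set option) \<Rightarrow> real" where
  "parent_weight f = (\<Prod>X\<in>UNIV. case f X of None \<Rightarrow> 1 | Some Y \<Rightarrow> up_down X Y)"

text \<open>Replacing \<open>t\<close> by an indeterminate grades the forests by their number of
  roots, and the coefficient of degree 1 is compared on both sides.\<close>

lemma sum_parent_weight:
  "(\<Sum>f :: ('a::{field,finite} ^ 'n) set \<Rightarrow> ('a ^ 'n) set option |
      wf (parent_rel f) \<and> card {X. vec.subspace X \<and> f X = None} = 1. parent_weight f) =
    (\<Prod>k=1..CARD('n). eigenvalue CARD('a) CARD('n) k ^ q_binomial TYPE('a ^ 'n) k)"
proof -
  \<comment> \<open>Only subspaces are counted: a set that is not a subspace has root weight 1 in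
    place of \<open>t\<close>.\<close>
  define roots where "roots f = card {X. vec.subspace X \<and> f X = None}"
    for f :: "('a ^ 'n) set \<Rightarrow> ('a ^ 'n) set option"
  define p where "p = (\<Sum>f | wf (parent_rel f). monom (parent_weight f) (roots f))"
  define R where "R = (\<Prod>k=1..CARD('n). [:eigenvalue CARD('a) CARD('n) k, 1:] ^ q_binomial TYPE('a ^ 'n) k)"
  have zero: "eigenvalue CARD('a) CARD('n) 0 = 0"
    by (simp add: eigenvalue_def q_int_def)
  have "poly p t = poly ([:0, 1:] * R) t" for t
  proof -
    have weight_t: "(\<Prod>X\<in>UNIV. case f X of None \<Rightarrow> if vec.subspace X then t else 1 | Some Y \<Rightarrow> up_down X Y) =
        t ^ roots f * parent_weight f" for f :: "('a ^ 'n) set \<Rightarrow> ('a ^ 'n) set option"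
    proof -
      have "(\<Prod>X\<in>UNIV. case f X of None \<Rightarrow> if vec.subspace X then t else 1 | Some Y \<Rightarrow> up_down X Y) =
          (\<Prod>X\<in>UNIV. (if vec.subspace X \<and> f X = None then t else 1) *
            (case f X of None \<Rightarrow> 1 | Some Y \<Rightarrow> up_down X Y))"
        by (intro prod.cong refl) (simp split: option.split)
      then show ?thesis
        by (simp add: prod.distrib parent_weight_def roots_def prod.If_cases)
    qed
    have "poly p t = (\<Sum>f | wf (parent_rel f). t ^ roots f * parent_weight f)"
      by (simp add: p_def poly_sum poly_monom mult.commute)
    also have "\<dots> = (\<Prod>Z :: ('a ^ 'n) set | vec.subspace Z. t + eigenvalue CARD('a) CARD('n) (vec.dim Z))"
      unfolding weight_t[symmetric] forest_theorem[symmetric] by (rule det_up_down_laplacian)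
    also have "\<dots> = poly ([:0, 1:] * R) t"
      unfolding prod_subspaces_by_dim[where g = "\<lambda>k. t + eigenvalue CARD('a) CARD('n) k"]
      by (simp add: R_def poly_prod zero add.commute)
    finally show ?thesis .
  qed
  \<comment> \<open>Polynomials that agree at every real number are equal.\<close>
  then have "p = [:0, 1:] * R" using poly_eq_poly_eq_iff by blast
  then have "coeff p 1 = coeff R 0" by simp
  also have "coeff R 0 = poly R 0" by (simp add: poly_0_coeff_0)
  also have "\<dots> = (\<Prod>k=1..CARD('n). eigenvalue CARD('a) CARD('n) k ^ q_binomial TYPE('a ^ 'n) k)"
    by (simp add: R_def poly_prod)
  also have "coeff p 1 = (\<Sum>f | wf (parent_rel f). if roots f = 1 then parent_weight f else 0)"
    by (simp add: p_def coeff_sum)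
  also have "\<dots> = (\<Sum>f | wf (parent_rel f) \<and> roots f = 1. parent_weight f)"
    by (simp add: sum.If_cases Int_def)
  finally show ?thesis by (simp only: roots_def)
qed

text \<open>Every parent is a cover or a hyperplane, and steps down have weight 1, so only the spin
  up edges remain.\<close>

lemma parent_weight_arborescence:
  fixes f :: "('a::{field,finite} ^ 'n) set \<Rightarrow> ('a ^ 'n) set option"
  assumes "tree_edges f \<subseteq> Cq_edges"
  shows "parent_weight f =
    real CARD('a) ^ (\<Sum>(X, Y) | f X = Some Y \<and> vec.dim Y = vec.dim X + 1. vec.dim X)"
proof -
  have edge: "covered X Y \<or> covered Y X" if "f X = Some Y" for X Y
    using that assms mem_Cq_edges_iff[of X Y] by (auto simp: tree_edges_def)
  define A where "A = {X. \<exists>Y. f X = Some Y \<and> vec.dim Y = vec.dim X + 1}"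
  have "parent_weight f = (\<Prod>X\<in>UNIV. if X \<in> A then real CARD('a) ^ vec.dim X else 1)"
    unfolding parent_weight_def
  proof (intro prod.cong refl)
    fix X
    show "(case f X of None \<Rightarrow> 1 | Some Y \<Rightarrow> up_down X Y) =
        (if X \<in> A then real CARD('a) ^ vec.dim X else 1)"
    proof (cases "f X")
      case (Some Y)
      from edge[OF this] show ?thesis
        by (auto simp: A_def up_down_def covered_def Some)
    qed (simp add: A_def)
  qed
  also have "\<dots> = real CARD('a) ^ (\<Sum>X\<in>A. vec.dim X)"
    by (simp add: prod.If_cases power_sum)
  also have "(\<Sum>X\<in>A. vec.dim X) = (\<Sum>(X, Y) | f X = Some Y \<and> vec.dim Y = vec.dim X + 1. vec.dim X)"
    by (rule sum.reindex_bij_witness[of _ fst "\<lambda>X. (X, the (f X))"]) (auto simp: A_def)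
  finally show ?thesis .
qed

text \<open>The root is the one subspace without a parent. The hypothesis on edges leaves all other
  sets parentless and makes every parent a subspace.\<close>

lemma arborescence_iff:
  fixes f :: "('a::{field,finite} ^ 'n) set \<Rightarrow> ('a ^ 'n) set option"
  assumes "tree_edges f \<subseteq> Cq_edges"
  shows "(\<exists>r. arborescence Cq_verts f r) \<longleftrightarrow>
    wf (parent_rel f) \<and> card {X. vec.subspace X \<and> f X = None} = 1"
proof
  assume "\<exists>r. arborescence Cq_verts f r"
  then obtain r where "arborescence Cq_verts f r" ..
  then interpret arborescence Cq_verts f r .
  have "{X. vec.subspace X \<and> f X = None} = {r}"
    using None_iff root by (auto simp: Cq_verts_def)
  then show "wf (parent_rel f) \<and> card {X. vec.subspace X \<and> f X = None} = 1"
    using wf by simp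
next
  assume *: "wf (parent_rel f) \<and> card {X. vec.subspace X \<and> f X = None} = 1"
  then obtain r where r: "{X. vec.subspace X \<and> f X = None} = {r}" by (metis card_1_singletonE)
  have r_iff: "vec.subspace X \<and> f X = None \<longleftrightarrow> X = r" for X
    using arg_cong[OF r, of "\<lambda>S. X \<in> S"] by simp
  have sub: "vec.subspace X" "vec.subspace Y" if "f X = Some Y" for X Y
    using that assms mem_Cq_edges_iff[of X Y] by (auto simp: tree_edges_def covered_def)
  have "arborescence Cq_verts f r"
  proof
    show "f X = None \<longleftrightarrow> X \<notin> Cq_verts \<or> X = r" for X
      using r_iff[of X] sub(1)[of X] by (cases "f X") (auto simp: Cq_verts_def)
  qed (use * r_iff[of r] sub(2) in \<open>auto simp: Cq_verts_def\<close>)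
  then show "\<exists>r. arborescence Cq_verts f r" ..
qed

theorem theorem1p3:
  fixes q n :: nat
  assumes "primepow q" and "n \<ge> 1"
    and "CARD('a::{field,finite}) = q" and "CARD('n::finite) = n"
  shows "(\<Sum>F\<in>(Cq_rooted_trees :: (('a ^ 'n) set set set \<times> ('a ^ 'n) set) set). q ^ weight F) =
    (\<Prod>k=1..n. ((1 + q ^ (n - k)) * q_int q k) ^ q_binomial TYPE('a ^ 'n) k)"
proof -
  \<comment> \<open>The weight is written through the oriented edges alone, the form that
    \<open>sum_rooted_spanning_trees\<close> accepts, and over the reals to match the
    determinants.\<close>
  define G :: "(('a ^ 'n) set \<times> ('a ^ 'n) set) set \<Rightarrow> real" where
    "G D = real q ^ (\<Sum>(X, Y) | (X, Y) \<in> D \<and> vec.dim Y = vec.dim X + 1. vec.dim X)" for D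
  have "real (\<Sum>F\<in>(Cq_rooted_trees :: (('a ^ 'n) set set set \<times> ('a ^ 'n) set) set). q ^ weight F) =
      (\<Sum>F\<in>rooted_spanning_trees Cq_verts Cq_edges. G (oriented_edges Cq_verts F))"
    by (simp add: Cq_rooted_trees_def weight_def spin_up_edges_def G_def)
  also have "\<dots> = (\<Sum>f :: ('a ^ 'n) set \<Rightarrow> ('a ^ 'n) set option |
      \<exists>r. arborescence Cq_verts f r \<and> tree_edges f \<subseteq> Cq_edges. G {(X, Y). f X = Some Y})"
    by (rule sum_rooted_spanning_trees) (force simp: Cq_edges_def Cq_verts_def)
  also have "\<dots> = (\<Sum>f :: ('a ^ 'n) set \<Rightarrow> ('a ^ 'n) set option |
      \<exists>r. arborescence Cq_verts f r \<and> tree_edges f \<subseteq> Cq_edges. parent_weight f)"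
    by (intro sum.cong refl) (auto simp: parent_weight_arborescence G_def assms(3))
  also have "\<dots> = (\<Sum>f :: ('a ^ 'n) set \<Rightarrow> ('a ^ 'n) set option |
      wf (parent_rel f) \<and> card {X. vec.subspace X \<and> f X = None} = 1. parent_weight f)"
  \<comment> \<open>The additional forests use some pair that is not an edge of the graph, so their
    weight is 0.\<close>
  proof (rule sum.mono_neutral_left)
    have "parent_weight f = 0" if not_sub: "\<not> tree_edges f \<subseteq> Cq_edges"
      for f :: "('a ^ 'n) set \<Rightarrow> ('a ^ 'n) set option"
    proof -
      obtain X Y where XY: "f X = Some Y" "{X, Y} \<notin> Cq_edges"
        using not_sub unfolding tree_edges_def by blast
      then have "(case f X of None \<Rightarrow> 1 | Some Y \<Rightarrow> up_down X Y) = 0"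
        by (simp add: up_down_def mem_Cq_edges_iff)
      then show ?thesis
        unfolding parent_weight_def by (intro prod_zero) auto
    qed
    then show "\<forall>f\<in>{f. wf (parent_rel f) \<and> card {X. vec.subspace X \<and> f X = None} = 1} -
        {f. \<exists>r. arborescence Cq_verts f r \<and> tree_edges f \<subseteq> Cq_edges}. parent_weight (f :: ('a ^ 'n) set \<Rightarrow> _) = 0"
      using arborescence_iff by blast
    show "{f :: ('a ^ 'n) set \<Rightarrow> ('a ^ 'n) set option.
          \<exists>r. arborescence Cq_verts f r \<and> tree_edges f \<subseteq> Cq_edges}
        \<subseteq> {f. wf (parent_rel f) \<and> card {X. vec.subspace X \<and> f X = None} = 1}"
      using arborescence_iff by blast
  qed simp
  also have "\<dots> = real (\<Prod>k=1..n. ((1 + q ^ (n - k)) * q_int q k) ^ q_binomial TYPE('a ^ 'n) k)"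
    unfolding sum_parent_weight by (simp add: eigenvalue_def assms(3,4))
  finally show ?thesis by (simp only: of_nat_eq_iff)
qed

end
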